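(* Let $\lambda\in\mathbb{R}$, let $x,y,z\in\mathbb{C}$ with $z\ne0$, and let $f_{\lambda}(t)=\sum_{k=0}^{\infty}a_{k}(t)_{k,\lambda}$ be a degenerate formal power series. Then $$\sum_{n=0}^{\infty}\frac{x^{n}}{n!}\bigg\{\sum_{k=0}^{n}\binom{n}{k}(-1)^{k}f_{\lambda}(y+kz)\bigg\}= \sum_{m=0}^{\infty}a_{m}\sum_{p=0}^{m}\binom{m}{p}(y)_{m-p,\lambda}z^{p}\phi_{p,\frac{\lambda}{z}}(-x).$$ In particular, for $y=0$, $$\sum_{n=0}^{\infty}\frac{x^{n}}{n!}\bigg\{\sum_{k=0}^{n}\binom{n}{k}(-1)^{k}f_{\lambda}(kz)\bigg\}= \sum_{m=0}^{\infty}a_{m}z^{m}\phi_{m,\frac{\lambda}{z}}(-x).$$ Both identities are understood formally in the coefficients $a_m$, i.e. for each $m\ge 0$ the coefficients of $a_m$ on the two sides are equal.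
   Context: For a complex number $\mu$, the $\mu$-falling factorials are $(x)_{0,\mu}=1$ and $(x)_{n,\mu}=x(x-\mu)(x-2\mu)\cdots(x-(n-1)\mu)$ for $n\ge1$. The degenerate exponential is the formal power series $e_{\mu}(t)=\sum_{n=0}^{\infty}\frac{(1)_{n,\mu}}{n!}t^{n}$. The degenerate Bell polynomials $\phi_{n,\mu}(x)$ are defined by $e^{x(e_{\mu}(t)-1)}=\sum_{n=0}^{\infty}\phi_{n,\mu}(x)\frac{t^{n}}{n!}$. A degenerate formal power series is an expression $f_{\lambda}(t)=\sum_{k=0}^{\infty}a_{k}(t)_{k,\lambda}$ with coefficients $a_0,a_1,a_2,\dots$; for a number $w$, $f_\lambda(w)$ denotes the formal sum $\sum_{m=0}^{\infty}a_m (w)_{m,\lambda}$. Each side of an identity is regarded as a formal linear combination $\sum_{m\ge0}a_m c_m$ with $c_m\in\mathbb{C}$; the outer sum over $n$ is carried out coefficientwise in the $a_m$ (for each $m$, the coefficient of $a_m$ in the inner braces vanishes for $n>m$, so only finitely many $n$ contribute). Convention: $x^0=1$. *)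

theory Defs
  imports Complex_Main "HOL-Computational_Algebra.Formal_Power_Series"
begin

definition deg_ffact :: "complex \<Rightarrow> complex \<Rightarrow> nat \<Rightarrow> complex" where
  "deg_ffact \<mu> x n = (\<Prod>i<n. x - of_nat i * \<mu>)"

definition deg_exp :: "complex \<Rightarrow> complex fps" where
  "deg_exp \<mu> = Abs_fps (\<lambda>n. deg_ffact \<mu> 1 n / fact n)"

text \<open>The composition is a genuine one, since \<open>deg_exp \<mu> - 1\<close> has constant term zero.\<close>

definition deg_bell :: "nat \<Rightarrow> complex \<Rightarrow> complex \<Rightarrow> complex" where
  "deg_bell n \<mu> x =
     fact n * fps_nth (fps_compose (fps_exp 1) (fps_const x * (deg_exp \<mu> - 1))) n"

text \<open>
  A formal linear combination \<open>\<Sum>m. a\<^sub>m * c m\<close> in the symbols \<open>a\<^sub>0, a\<^sub>1, \<dots>\<close> is represented by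
  its sequence \<open>c\<close> of complex coefficients; the symbols themselves carry no value, so two
  combinations are equal iff for each \<open>m\<close> their coefficients of \<open>a\<^sub>m\<close> are.
\<close>

type_synonym formal_comb = "nat \<Rightarrow> complex"

text \<open>
  The value at \<open>w\<close> of the degenerate formal power series \<open>f(t) = \<Sum>k. a\<^sub>k * deg_ffact l t k\<close>,
  as a formal linear combination of its coefficients: \<open>deg_series_at l w m\<close> is the coefficient
  of \<open>a\<^sub>m\<close> in \<open>f(w)\<close>.
\<close>

definition deg_series_at :: "complex \<Rightarrow> complex \<Rightarrow> formal_comb" where
  "deg_series_at l w = (\<lambda>m. deg_ffact l w m)"

text \<open>
  Purely algebraic infinite summation of formal linear combinations: to each \<open>a\<^sub>m\<close> only finitely
  many of the \<open>F n\<close> contribute, and their contributions add up to the coefficient of \<open>a\<^sub>m\<close> in \<open>S\<close>.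
\<close>

definition coeffwise_sums :: "(nat \<Rightarrow> formal_comb) \<Rightarrow> formal_comb \<Rightarrow> bool" where
  "coeffwise_sums F S \<longleftrightarrow>
     (\<forall>m. finite {n. F n m \<noteq> 0} \<and> (\<Sum>n\<in>{n. F n m \<noteq> 0}. F n m) = S m)"

end

theory Submission
  imports Defs
begin

text \<open>
  The proof runs through the exponential generating function
  \<open>E\<^sub>w(t) = \<Sum>m. (w)\<^sub>m t\<^sup>m / m!\<close> of the falling factorials \<open>(w)\<^sub>m\<close> with step \<open>\<lambda>\<close>, that is,
  \<open>(1 + \<lambda>t)\<^bsup>w/\<lambda>\<^esup>\<close> for \<open>\<lambda> \<noteq> 0\<close> and \<open>e\<^bsup>wt\<^esup>\<close> for \<open>\<lambda> = 0\<close>. It turns addition of arguments into multiplication, so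
  \<open>E\<^bsub>y+kz\<^esub> = E\<^sub>y E\<^sub>z\<^sup>k\<close>, and by the binomial theorem the alternating sum in the inner braces has
  exponential generating function \<open>E\<^sub>y (1 - E\<^sub>z)\<^sup>n\<close> (lemma \<open>alternating_sum_deg_egf\<close>).

  As \<open>1 - E\<^sub>z\<close> has no constant term, the coefficient of \<open>t\<^sup>m\<close> in this series vanishes for \<open>n > m\<close>.
  Hence the outer sum is finite for each \<open>m\<close>, and it is the coefficient of \<open>t\<^sup>m\<close>, times \<open>m!\<close>, in
  \<open>E\<^sub>y exp (- x (E\<^sub>z - 1))\<close>. Finally \<open>E\<^sub>z(t) = e\<^sub>\<mu>(zt)\<close> with \<open>\<mu> = \<lambda>/z\<close>, so the exponential factor is
  the exponential generating function of the degenerate Bell polynomials evaluated at \<open>zt\<close>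
  (lemma \<open>sum_powers_deg_egf_eq_deg_bell\<close>), and the Cauchy product with \<open>E\<^sub>y\<close> is the right-hand
  side. For \<open>y = 0\<close> the first factor is \<open>1\<close>.
\<close>

definition deg_egf :: "complex \<Rightarrow> complex \<Rightarrow> complex fps" where
  "deg_egf l w = Abs_fps (\<lambda>n. deg_ffact l w n / fact n)"

lemma deg_ffact_0 [simp]: "deg_ffact l w 0 = 1"
  by (simp add: deg_ffact_def)

lemma deg_ffact_Suc: "deg_ffact l w (Suc n) = deg_ffact l w n * (w - of_nat n * l)"
  by (simp add: deg_ffact_def)

lemma deg_ffact_zero_left: "deg_ffact l 0 n = (if n = 0 then 1 else 0)"
  by (induction n) (auto simp: deg_ffact_Suc)

lemma deg_ffact_scale:
  assumes "z \<noteq> 0"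
  shows "deg_ffact l z n = z ^ n * deg_ffact (l / z) 1 n"
proof (induction n)
  case (Suc n)
  have "z - of_nat n * l = z * (1 - of_nat n * (l / z))"
    using assms by (simp add: field_simps)
  with Suc show ?case by (simp only: deg_ffact_Suc power_Suc mult_ac)
qed simp

lemma deg_egf_nth [simp]: "fps_nth (deg_egf l w) n = deg_ffact l w n / fact n"
  by (simp add: deg_egf_def)

lemma deg_egf_ODE: "(1 + fps_const l * fps_X) * fps_deriv (deg_egf l w) = fps_const w * deg_egf l w"
proof (rule fps_ext)
  fix n
  show "fps_nth ((1 + fps_const l * fps_X) * fps_deriv (deg_egf l w)) n
      = fps_nth (fps_const w * deg_egf l w) n"
    by (cases n)
      (simp_all add: distrib_right mult.assoc deg_ffact_Suc fact_Suc divide_simps del: of_nat_Suc,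
       simp add: algebra_simps)
qed

text \<open>
  The differential equation amounts to a first-order recursion for the coefficients, so identities
  between these series hold as soon as both sides solve it and have constant term \<open>1\<close>; this
  covers all values of \<open>l\<close> at once.
\<close>

lemma deg_egf_unique:
  assumes ode: "(1 + fps_const l * fps_X) * fps_deriv F = fps_const w * F"
    and init: "fps_nth F 0 = 1"
  shows "F = deg_egf l w"
proof (rule fps_ext)
  fix n
  show "fps_nth F n = fps_nth (deg_egf l w) n"
  proof (induction n)
    case 0
    show ?case using init by simp
  next
    case (Suc n)
    have step: "of_nat (Suc n) * fps_nth G (Suc n) = (w - of_nat n * l) * fps_nth G n"
      if G: "(1 + fps_const l * fps_X) * fps_deriv G = fps_const w * G" for G
    proof -
      have "fps_nth ((1 + fps_const l * fps_X) * fps_deriv G) n = w * fps_nth G n"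
        by (simp add: G)
      then show ?thesis
        by (cases n) (simp_all add: distrib_right mult.assoc algebra_simps)
    qed
    have "of_nat (Suc n) * fps_nth F (Suc n) = of_nat (Suc n) * fps_nth (deg_egf l w) (Suc n)"
      by (simp only: step[OF ode] step[OF deg_egf_ODE] Suc.IH)
    then show ?case
      by (simp only: mult_cancel_left of_nat_eq_0_iff) simp
  qed
qed

text \<open>
  Vandermonde's identity for the degenerate falling factorials: by the Leibniz rule, the product
  solves the differential equation that characterises the left-hand side.
\<close>

lemma deg_egf_add: "deg_egf l (a + b) = deg_egf l a * deg_egf l b"
proof (rule deg_egf_unique[symmetric])
  let ?D = "1 + fps_const l * fps_X"
  have "?D * fps_deriv (deg_egf l a * deg_egf l b)
      = deg_egf l a * (?D * fps_deriv (deg_egf l b)) + (?D * fps_deriv (deg_egf l a)) * deg_egf l b"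
    by (simp add: algebra_simps)
  also have "\<dots> = (fps_const a + fps_const b) * (deg_egf l a * deg_egf l b)"
    by (simp only: deg_egf_ODE) (simp only: algebra_simps)
  finally show "?D * fps_deriv (deg_egf l a * deg_egf l b)
      = fps_const (a + b) * (deg_egf l a * deg_egf l b)"
    by (simp only: fps_const_add)
qed simp

lemma deg_egf_0: "deg_egf l 0 = 1"
  by (rule fps_ext) (simp add: deg_ffact_zero_left)

lemma deg_egf_add_of_nat_mult: "deg_egf l (y + of_nat k * z) = deg_egf l y * deg_egf l z ^ k"
proof (induction k)
  case (Suc k)
  have "y + of_nat (Suc k) * z = (y + of_nat k * z) + z"
    by (simp add: algebra_simps)
  then have "deg_egf l (y + of_nat (Suc k) * z) = deg_egf l (y + of_nat k * z) * deg_egf l z"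
    by (simp only: deg_egf_add[of l "y + of_nat k * z"])
  with Suc show ?case
    by (simp only: power_Suc mult_ac)
qed simp

lemma alternating_sum_deg_egf:
  "(\<Sum>k=0..n. of_nat (n choose k) * (-1) ^ k * deg_ffact l (y + of_nat k * z) m)
     = fact m * fps_nth (deg_egf l y * (1 - deg_egf l z) ^ n) m"
proof -
  have "(1 - deg_egf l z) ^ n = (\<Sum>k\<le>n. of_nat (n choose k) * (- deg_egf l z) ^ k)"
    using binomial_ring[of "- deg_egf l z" 1 n] by simp
  moreover have "deg_egf l y * (of_nat (n choose k) * (- deg_egf l z) ^ k)
      = fps_const (of_nat (n choose k) * (-1) ^ k) * deg_egf l (y + of_nat k * z)" for k
  proof -
    have "fps_const (of_nat (n choose k) * (-1) ^ k) = (of_nat (n choose k) * (-1) ^ k :: complex fps)"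
      by (simp add: fps_of_nat flip: fps_const_mult fps_const_power fps_const_neg)
    then show ?thesis
      by (simp only: deg_egf_add_of_nat_mult power_minus[of "deg_egf l z"]) (simp only: mult_ac)
  qed
  ultimately have "deg_egf l y * (1 - deg_egf l z) ^ n
      = (\<Sum>k\<le>n. fps_const (of_nat (n choose k) * (-1) ^ k) * deg_egf l (y + of_nat k * z))"
    by (simp only: sum_distrib_left)
  then have "fact m * fps_nth (deg_egf l y * (1 - deg_egf l z) ^ n) m
      = (\<Sum>k\<le>n. of_nat (n choose k) * (-1) ^ k * deg_ffact l (y + of_nat k * z) m)"
    by (simp add: fps_sum_nth sum_distrib_left)
  then show ?thesis by (simp add: atMost_atLeast0)
qed

lemma deg_egf_power_nth_eq_0:
  assumes "m < n"
  shows "fps_nth ((1 - deg_egf l z) ^ n) m = 0"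
  using assms by (intro startsby_zero_power_prefix[rule_format]) auto

lemma deg_egf_eq_deg_exp_scaled:
  assumes "z \<noteq> 0"
  shows "deg_egf l z = deg_exp (l / z) oo (fps_const z * fps_X)"
  by (rule fps_ext) (simp add: deg_exp_def fps_compose_linear deg_ffact_scale[OF assms])

text \<open>
  The left-hand side is the coefficient of \<open>t\<^sup>p\<close> in \<open>exp (- x (E\<^sub>z(t) - 1))\<close>. Substituting
  \<open>E\<^sub>z(t) = e\<^bsub>l/z\<^esub>(zt)\<close> makes it that of the Bell generating function in the variable \<open>zt\<close>, which
  accounts for \<open>z\<^sup>p\<close>. The upper limit is any \<open>m \<ge> p\<close>, so that one range of summation serves all
  terms of a Cauchy product.
\<close>

lemma sum_powers_deg_egf_eq_deg_bell:
  assumes "z \<noteq> 0" and "p \<le> m"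
  shows "(\<Sum>n\<le>m. x ^ n / fact n * fps_nth ((1 - deg_egf l z) ^ n) p)
     = z ^ p * deg_bell p (l / z) (- x) / fact p"
proof -
  let ?A = "fps_const (- x) * (deg_exp (l / z) - 1)"
  have pow: "x ^ n * fps_nth ((1 - deg_egf l z) ^ n) p = z ^ p * fps_nth (?A ^ n) p" for n
  proof -
    have "fps_const x * (1 - deg_egf l z) = ?A oo (fps_const z * fps_X)"
      by (simp add: deg_egf_eq_deg_exp_scaled[OF assms(1)] fps_compose_mult_distrib
          fps_compose_sub_distrib algebra_simps flip: fps_const_neg)
    then have "(fps_const x * (1 - deg_egf l z)) ^ n = ?A ^ n oo (fps_const z * fps_X)"
      by (simp add: fps_compose_power)
    then have "fps_const (x ^ n) * (1 - deg_egf l z) ^ n = ?A ^ n oo (fps_const z * fps_X)"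
      by (simp add: power_mult_distrib)
    from arg_cong[OF this, of "\<lambda>F. fps_nth F p"] show ?thesis
      by (simp add: fps_compose_linear)
  qed
  have "(\<Sum>n\<le>m. x ^ n / fact n * fps_nth ((1 - deg_egf l z) ^ n) p)
      = (\<Sum>n\<le>p. x ^ n / fact n * fps_nth ((1 - deg_egf l z) ^ n) p)"
    using assms(2) by (intro sum.mono_neutral_right) (auto simp: deg_egf_power_nth_eq_0)
  also have "\<dots> = (\<Sum>n\<le>p. z ^ p * (fps_nth (?A ^ n) p / fact n))"
    by (intro sum.cong refl) (simp only: times_divide_eq_left times_divide_eq_right pow)
  also have "\<dots> = z ^ p * deg_bell p (l / z) (- x) / fact p"
    by (simp add: deg_bell_def fps_compose_nth atMost_atLeast0) (simp add: sum_distrib_left)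
  finally show ?thesis .
qed

lemma coeffwise_sumsI:
  assumes "\<And>m n. m < n \<Longrightarrow> F n m = 0" and "\<And>m. (\<Sum>n\<le>m. F n m) = S m"
  shows "coeffwise_sums F S"
  unfolding coeffwise_sums_def
proof (intro allI conjI)
  fix m
  have support: "{n. F n m \<noteq> 0} \<subseteq> {..m}"
    using assms(1) by (force simp: not_less[symmetric])
  then show "finite {n. F n m \<noteq> 0}"
    by (rule finite_subset) simp
  from support have "(\<Sum>n\<in>{n. F n m \<noteq> 0}. F n m) = (\<Sum>n\<le>m. F n m)"
    by (intro sum.mono_neutral_left) auto
  then show "(\<Sum>n\<in>{n. F n m \<noteq> 0}. F n m) = S m"
    by (simp add: assms(2))
qed

lemma coeffwise_sums_deg_bell:
  assumes "z \<noteq> 0"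
  shows "coeffwise_sums
           (\<lambda>n m. x ^ n / fact n *
              (\<Sum>k=0..n. of_nat (n choose k) * (-1) ^ k * deg_series_at l (y + of_nat k * z) m))
           (\<lambda>m. \<Sum>p=0..m. of_nat (m choose p) * deg_ffact l y (m - p) *
                 z ^ p * deg_bell p (l / z) (- x))"
  unfolding deg_series_at_def alternating_sum_deg_egf
proof (rule coeffwise_sumsI)
  fix m n :: nat
  assume "m < n"
  then show "x ^ n / fact n * (fact m * fps_nth (deg_egf l y * (1 - deg_egf l z) ^ n) m) = 0"
    by (simp add: fps_mult_nth deg_egf_power_nth_eq_0)
next
  fix m
  have cauchy: "fps_nth (deg_egf l y * P) m = (\<Sum>p=0..m.
      deg_ffact l y (m - p) / fact (m - p) * fps_nth P p)" for P
    by (subst mult.commute) (simp add: fps_mult_nth mult.commute)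
  have "(\<Sum>n\<le>m. x ^ n / fact n * (fact m * fps_nth (deg_egf l y * (1 - deg_egf l z) ^ n) m))
      = (\<Sum>n\<le>m. \<Sum>p=0..m. fact m * (deg_ffact l y (m - p) / fact (m - p)) *
           (x ^ n / fact n * fps_nth ((1 - deg_egf l z) ^ n) p))"
    by (simp add: cauchy sum_distrib_left mult_ac)
  also have "\<dots> = (\<Sum>p=0..m. fact m * (deg_ffact l y (m - p) / fact (m - p)) *
           (\<Sum>n\<le>m. x ^ n / fact n * fps_nth ((1 - deg_egf l z) ^ n) p))"
    by (subst sum.swap) (simp only: sum_distrib_left)
  also have "\<dots> = (\<Sum>p=0..m. of_nat (m choose p) * deg_ffact l y (m - p) *
                 z ^ p * deg_bell p (l / z) (- x))"
  proof (intro sum.cong refl)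
    fix p
    assume "p \<in> {0..m}"
    then have "p \<le> m" by simp
    then show "fact m * (deg_ffact l y (m - p) / fact (m - p)) *
           (\<Sum>n\<le>m. x ^ n / fact n * fps_nth ((1 - deg_egf l z) ^ n) p)
        = of_nat (m choose p) * deg_ffact l y (m - p) * z ^ p * deg_bell p (l / z) (- x)"
      by (simp only: sum_powers_deg_egf_eq_deg_bell[OF assms] binomial_fact)
        (simp add: field_simps)
  qed
  finally show "(\<Sum>n\<le>m. x ^ n / fact n *
        (fact m * fps_nth (deg_egf l y * (1 - deg_egf l z) ^ n) m))
      = (\<Sum>p=0..m. of_nat (m choose p) * deg_ffact l y (m - p) *
                 z ^ p * deg_bell p (l / z) (- x))" .
qed

theorem theorem10:
  fixes lam :: real and x y z :: complex
  assumes "z \<noteq> 0"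
  shows "coeffwise_sums
           (\<lambda>n m. x ^ n / fact n *
              (\<Sum>k=0..n. of_nat (n choose k) * (-1) ^ k *
                 deg_series_at (complex_of_real lam) (y + of_nat k * z) m))
           (\<lambda>m. \<Sum>p=0..m. of_nat (m choose p) * deg_ffact (complex_of_real lam) y (m - p) *
                 z ^ p * deg_bell p (complex_of_real lam / z) (- x))
         \<and> coeffwise_sums
           (\<lambda>n m. x ^ n / fact n *
              (\<Sum>k=0..n. of_nat (n choose k) * (-1) ^ k *
                 deg_series_at (complex_of_real lam) (of_nat k * z) m))
           (\<lambda>m. z ^ m * deg_bell m (complex_of_real lam / z) (- x))"
proof
  let ?l = "complex_of_real lam"
  have "(\<Sum>p=0..m. of_nat (m choose p) * deg_ffact ?l 0 (m - p) * z ^ p * deg_bell p (?l / z) (- x))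
      = z ^ m * deg_bell m (?l / z) (- x)" for m
  proof -
    have "(\<Sum>p=0..m. of_nat (m choose p) * deg_ffact ?l 0 (m - p) * z ^ p * deg_bell p (?l / z) (- x))
        = (\<Sum>p=0..m. if p = m then z ^ m * deg_bell m (?l / z) (- x) else 0)"
      by (intro sum.cong refl) (auto simp: deg_ffact_zero_left)
    then show ?thesis by simp
  qed
  with coeffwise_sums_deg_bell[OF assms, of x ?l 0]
  show "coeffwise_sums
           (\<lambda>n m. x ^ n / fact n *
              (\<Sum>k=0..n. of_nat (n choose k) * (-1) ^ k * deg_series_at ?l (of_nat k * z) m))
           (\<lambda>m. z ^ m * deg_bell m (?l / z) (- x))"
    by simp
qed (rule coeffwise_sums_deg_bell[OF assms])

end
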